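(* The vector $\omega_{F_4}$ is given by \begin{eqnarray*} &&\frac{1}{5} \left[4\lambda_1(-1)^2 - 4\lambda_1(-1)\lambda_3(-1) -\lambda_1(-1)\lambda_5(-1) + 2\lambda_1(-1)\lambda_6(-1) \right. \\ &&+ 5\lambda_2(-1)^2 - 5\lambda_2(-1)\lambda_4(-1) +4\lambda_3(-1)^2 - 5\lambda_3(-1)\lambda_4(-1) \\ &&+ 2\lambda_3(-1)\lambda_5(-1) - \lambda_3(-1)\lambda_6(-1) + 5\lambda_4(-1)^2 - 5\lambda_4(-1)\lambda_5(-1) \\ &&\left. + 4\lambda_5(-1)^2 - 4\lambda_5(-1)\lambda_6(-1) +4\lambda_6(-1)^2 \right]\otimes e^0 \\ &&+\frac{1}{5}\left(1\otimes e^{\alpha_1-\alpha_6}+1\otimes e^{\alpha_3-\alpha_5} - 1\otimes e^{\alpha_1+\alpha_3-\alpha_5-\alpha_6}\right) \\ &&+ \frac{1}{5}\left(1\otimes e^{-\alpha_1+\alpha_6}+1\otimes e^{-\alpha_3+\alpha_5} - 1\otimes e^{-\alpha_1-\alpha_3+\alpha_5+\alpha_6}\right). \end{eqnarray*}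
   Context: Let $\mathfrak{g}$ be the simple Lie algebra of type $E_6$ with simple roots $\alpha_1,\dots,\alpha_6$ (Bourbaki labelling: $\alpha_2$ is the branch node attached to $\alpha_4$, and $\alpha_1,\alpha_3,\alpha_4,\alpha_5,\alpha_6$ form a chain), fundamental weights $\lambda_1,\dots,\lambda_6$, and normalized invariant form with $\langle\alpha,\alpha\rangle=2$ for roots. Let $P=\sum_i\mathbb{Z}\lambda_i$ be the weight lattice and $V_P=S(\widehat{\mathfrak{h}}^-_{\mathbb{Z}})\otimes\mathbb{C}[P]$ the lattice vertex operator algebra (module) construction, where $\lambda(-n)$ denotes the Heisenberg operator for $\lambda\in\mathfrak{h}$ (identified with $\mathfrak{h}^*$) and $1\otimes e^\gamma$ is the group-algebra element for $\gamma\in P$. The vertex operators for $1\otimes e^\alpha$ are built using the $\tau$-invariant bilinear 2-cocycle $\varepsilon$ on the root lattice determined by the values $[\varepsilon(\alpha_i,\alpha_j)]$ with rows $(1,1,-1,1,1,1)$, $(1,1,1,-1,1,1)$, $(1,1,1,-1,1,1)$, $(1,1,1,1,1,1)$, $(1,1,1,-1,1,1)$, $(1,1,1,1,-1,1)$, so that $e_\alpha\cdot e^\beta=\varepsilon(\alpha,\beta)e^{\alpha+\beta}$. Let $\tau$ be the order-2 diagram automorphism of $E_6$ ($\alpha_1\leftrightarrow\alpha_6$, $\alpha_3\leftrightarrow\alpha_5$, $\alpha_2,\alpha_4$ fixed), and let $\mathfrak{a}\subset\mathfrak{g}$ be the fixed-point subalgebra of type $F_4$, with affine subalgebra $\tilde{\mathfrak{a}}$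 of type $F_4^{(1)}$ inside $\tilde{\mathfrak{g}}$ of type $E_6^{(1)}$. Let $\{u_i\}$ be a basis of $\mathfrak{a}$ (root vectors $x_\alpha$ for $\tau$-fixed roots $\alpha$, $x_\alpha+x_{\tau\alpha}$ for non-fixed pairs, and Cartan elements), and $\{u^i\}$ the dual basis with respect to the invariant form. The vector $\omega_{F_4}\in V_P$ is the Sugawara conformal vector for $\tilde{\mathfrak{a}}$ at level 1 (dual Coxeter number of $F_4$ is $9$): $$\omega_{F_4} = \frac{1}{20} \sum_{n\in \mathbb{Z}}\sum_i :u_i(-n)u^i(-2+n):\cdot (1\otimes e^0).$$ *)

theory Defs
  imports Complex_Main "HOL-Library.Poly_Mapping" "HOL-Library.Groups_Big_Fun"
begin

text \<open>Conventions.  Indices of simple roots / fundamental weights run over {1..6}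
 (Bourbaki labelling).  Elements of the weight lattice P are written in the basis of
 fundamental weights lambda_1..lambda_6 (type lat).  Elements of h (= h*) are complex
 coordinate vectors in the same basis (type hvec).  The Fock space S(h^-) is the
 polynomial algebra in the variables lambda_i(-n), i in {1..6}, n >= 1; a monomial is a
 finitely supported exponent function on pairs (i,n) (type mono).  V_P is the complex
 vector space with basis the pairs (monomial, gamma) = monomial tensor e^gamma.\<close>

type_synonym mono = "(nat \<times> nat) \<Rightarrow>\<^sub>0 nat"
type_synonym lat = "nat \<Rightarrow>\<^sub>0 int"
type_synonym hvec = "nat \<Rightarrow> complex"
type_synonym V = "(mono \<times> lat) \<Rightarrow>\<^sub>0 complex"

text \<open>Cartan matrix of E6 (Bourbaki) and its inverse; the inverse gives the Gram matrix
 of the normalized form on fundamental weights.\<close>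

definition cartanL :: "int list list" where
  "cartanL = [[2,0,-1,0,0,0],[0,2,0,-1,0,0],[-1,0,2,-1,0,0],
              [0,-1,-1,2,-1,0],[0,0,0,-1,2,-1],[0,0,0,0,-1,2]]"

definition cartan :: "nat \<Rightarrow> nat \<Rightarrow> int" where
  "cartan i j = cartanL ! (i - 1) ! (j - 1)"

definition ginvL :: "int list list" where
  "ginvL = [[4,3,5,6,4,2],[3,6,6,9,6,3],[5,6,10,12,8,4],
            [6,9,12,18,12,6],[4,6,8,12,10,5],[2,3,4,6,5,4]]"

text \<open>Gram matrix of the fundamental weights: <lambda_i, lambda_j> = ginv i j.\<close>
definition ginv :: "nat \<Rightarrow> nat \<Rightarrow> rat" where
  "ginv i j = of_int (ginvL ! (i - 1) ! (j - 1)) / 3"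

definition lat_of :: "(nat \<Rightarrow> int) \<Rightarrow> lat" where
  "lat_of f = (\<Sum>j\<in>{1..6}. Poly_Mapping.single j (f j))"

definition sroot :: "nat \<Rightarrow> lat" where
  "sroot i = lat_of (\<lambda>j. cartan i j)"

definition P_lat :: "lat set" where
  "P_lat = {\<gamma>. Poly_Mapping.keys \<gamma> \<subseteq> {1..6}}"

definition hv_of_lat :: "lat \<Rightarrow> hvec" where
  "hv_of_lat \<gamma> = (\<lambda>i. of_int (Poly_Mapping.lookup \<gamma> i))"

definition fwv :: "nat \<Rightarrow> hvec" where
  "fwv j = (\<lambda>i. if i = j then 1 else 0)"

definition hform :: "hvec \<Rightarrow> hvec \<Rightarrow> complex" where
  "hform h k = (\<Sum>i\<in>{1..6}. \<Sum>j\<in>{1..6}. h i * of_rat (ginv i j) * k j)"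

definition lform :: "lat \<Rightarrow> lat \<Rightarrow> rat" where
  "lform \<gamma> \<delta> = (\<Sum>i\<in>{1..6}. \<Sum>j\<in>{1..6}. of_int (Poly_Mapping.lookup \<gamma> i) * ginv i j * of_int (Poly_Mapping.lookup \<delta> j))"

text \<open>coordinates w.r.t. the simple roots: rootc gamma j = <gamma, lambda_j>\<close>
definition rootc :: "lat \<Rightarrow> nat \<Rightarrow> rat" where
  "rootc \<gamma> j = (\<Sum>k\<in>{1..6}. of_int (Poly_Mapping.lookup \<gamma> k) * ginv k j)"

definition Q_lat :: "lat set" where
  "Q_lat = {\<gamma> \<in> P_lat. \<forall>j\<in>{1..6}. rootc \<gamma> j \<in> \<int>}"

definition E6roots :: "lat set" where
  "E6roots = {\<gamma> \<in> Q_lat. lform \<gamma> \<gamma> = 2}"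

text \<open>Values of the cocycle on simple roots: epsL ! (i-1) ! (j-1) = eps(alpha_i, alpha_j).\<close>
definition epsL :: "int list list" where
  "epsL = [[1,1,-1,1,1,1],[1,1,1,-1,1,1],[1,1,1,-1,1,1],
           [1,1,1,1,1,1],[1,1,1,-1,1,1],[1,1,1,1,-1,1]]"

text \<open>Bimultiplicative extension to the root lattice; outside Q x Q (which never occurs
 for the vectors considered here) the value is fixed to 1 by convention.\<close>
definition cocycle :: "lat \<Rightarrow> lat \<Rightarrow> complex" where
  "cocycle \<alpha> \<beta> =
    (if \<alpha> \<in> Q_lat \<and> \<beta> \<in> Q_lat then
       (-1) ^ nat \<bar>\<Sum>i\<in>{1..6}. \<Sum>j\<in>{1..6}.
          (if epsL ! (i - 1) ! (j - 1) = -1 then \<lfloor>rootc \<alpha> i\<rfloor> * \<lfloor>rootc \<beta> j\<rfloor> else 0)\<bar>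
     else 1)"

definition basisv :: "mono \<times> lat \<Rightarrow> V" where
  "basisv k = Poly_Mapping.single k 1"

definition scaleV :: "complex \<Rightarrow> V \<Rightarrow> V" where
  "scaleV c v = Poly_Mapping.map (\<lambda>x. c * x) v"

definition lin :: "(mono \<times> lat \<Rightarrow> V) \<Rightarrow> V \<Rightarrow> V" where
  "lin T v = (\<Sum>k\<in>Poly_Mapping.keys v. scaleV (Poly_Mapping.lookup v k) (T k))"

definition heis_b :: "hvec \<Rightarrow> int \<Rightarrow> mono \<times> lat \<Rightarrow> V" where
  "heis_b h n k = (case k of (m, \<gamma>) \<Rightarrow>
     if n < 0 then
       (\<Sum>i\<in>{1..6}. scaleV (h i) (basisv (m + Poly_Mapping.single (i, nat (- n)) 1, \<gamma>)))
     else if n = 0 then scaleV (hform h (hv_of_lat \<gamma>)) (basisv (m, \<gamma>))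
     else (\<Sum>j\<in>{1..6}. scaleV (of_int n * hform h (fwv j) * of_nat (Poly_Mapping.lookup m (j, nat n)))
                (basisv (m - Poly_Mapping.single (j, nat n) 1, \<gamma>))))"

definition heis :: "hvec \<Rightarrow> int \<Rightarrow> V \<Rightarrow> V" where
  "heis h n = lin (heis_b h n)"

subsection \<open>Lattice vertex operators Y(e^alpha, z) = E^-(-alpha,z) E^+(-alpha,z) e_alpha z^alpha\<close>

text \<open>Em a p = coefficient of z^p in exp(sum_{n>=1} a(-n) z^n / n);
 Ep a q = coefficient of z^(-q) in exp(- sum_{n>=1} a(n) z^(-n) / n).\<close>

function Em :: "hvec \<Rightarrow> nat \<Rightarrow> V \<Rightarrow> V" where
  "Em a p v = (if p = 0 then v else
     scaleV (1 / of_nat p) (\<Sum>n\<in>{1..p}. heis a (- int n) (Em a (p - n) v)))"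
  by pat_completeness auto
termination by (relation "measure (\<lambda>(a, p, v). p)") auto

function Ep :: "hvec \<Rightarrow> nat \<Rightarrow> V \<Rightarrow> V" where
  "Ep a q v = (if q = 0 then v else
     scaleV (1 / of_nat q) (\<Sum>n\<in>{1..q}. - heis a (int n) (Ep a (q - n) v)))"
  by pat_completeness auto
termination by (relation "measure (\<lambda>(a, q, v). q)") auto

text \<open>degree (energy) of a monomial; E^+ coefficients of order > wt m kill m\<close>
definition wt :: "mono \<Rightarrow> nat" where
  "wt m = (\<Sum>k\<in>Poly_Mapping.keys m. snd k * Poly_Mapping.lookup m k)"

definition ipair :: "lat \<Rightarrow> lat \<Rightarrow> int" where
  "ipair \<alpha> \<beta> = \<lfloor>lform \<alpha> \<beta>\<rfloor>"

text \<open>mode e^alpha_(k), the coefficient of z^(-k-1) in Y(e^alpha, z)\<close>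
definition vop_b :: "lat \<Rightarrow> int \<Rightarrow> mono \<times> lat \<Rightarrow> V" where
  "vop_b \<alpha> k key = (case key of (m, \<beta>) \<Rightarrow>
     scaleV (cocycle \<alpha> \<beta>)
       (\<Sum>q\<in>{0..wt m}.
          if - k - 1 - ipair \<alpha> \<beta> + int q \<ge> 0
          then Em (hv_of_lat \<alpha>) (nat (- k - 1 - ipair \<alpha> \<beta> + int q))
                 (Ep (hv_of_lat \<alpha>) q (basisv (m, \<alpha> + \<beta>)))
          else 0))"

definition vop :: "lat \<Rightarrow> int \<Rightarrow> V \<Rightarrow> V" where
  "vop \<alpha> k = lin (vop_b \<alpha> k)"

definition vac :: V where
  "vac = basisv (0, 0)"

definition estate :: "lat \<Rightarrow> V" where
  "estate \<gamma> = basisv (0, \<gamma>)"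

text \<open>x tensor t^k acting on V_P, for a basis state x of g: e^gamma  gives e^gamma_(k),
 lambda_i(-1) tensor e^0 gives lambda_i(k); other basis states do not occur in g.\<close>
definition mode_b :: "mono \<times> lat \<Rightarrow> int \<Rightarrow> V \<Rightarrow> V" where
  "mode_b key k = (case key of (m, \<gamma>) \<Rightarrow>
     if m = 0 then vop \<gamma> k
     else if \<gamma> = 0 \<and> (\<exists>i\<in>{1..6}. m = Poly_Mapping.single (i, 1) 1)
       then heis (\<lambda>i. of_nat (Poly_Mapping.lookup m (i, 1))) k
     else (\<lambda>v. 0))"

definition aff :: "V \<Rightarrow> int \<Rightarrow> V \<Rightarrow> V" where
  "aff a k v = (\<Sum>key\<in>Poly_Mapping.keys a. scaleV (Poly_Mapping.lookup a key) (mode_b key k v))"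

definition gkeys :: "(mono \<times> lat) set" where
  "gkeys = {(0, \<alpha>) | \<alpha>. \<alpha> \<in> E6roots} \<union> {(Poly_Mapping.single (i, 1) 1, 0) | i. i \<in> {1..6}}"

definition gE6 :: "V set" where
  "gE6 = {v. Poly_Mapping.keys v \<subseteq> gkeys}"

text \<open>normalized invariant form: a_(1) b = (a,b) vac\<close>
definition invform :: "V \<Rightarrow> V \<Rightarrow> complex" where
  "invform a b = Poly_Mapping.lookup (aff a 1 b) (0, 0)"

definition tperm :: "nat \<Rightarrow> nat" where
  "tperm i = (if i = 1 then 6 else if i = 6 then 1 else if i = 3 then 5 else if i = 5 then 3 else i)"

definition tau_lat :: "lat \<Rightarrow> lat" where
  "tau_lat \<gamma> = (\<Sum>i\<in>Poly_Mapping.keys \<gamma>. Poly_Mapping.single (tperm i) (Poly_Mapping.lookup \<gamma> i))"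

definition tau_mono :: "mono \<Rightarrow> mono" where
  "tau_mono m = (\<Sum>k\<in>Poly_Mapping.keys m. Poly_Mapping.single (tperm (fst k), snd k) (Poly_Mapping.lookup m k))"

definition tauV :: "V \<Rightarrow> V" where
  "tauV = lin (\<lambda>(m, \<gamma>). basisv (tau_mono m, tau_lat \<gamma>))"

definition aF4 :: "V set" where
  "aF4 = {v \<in> gE6. tauV v = v}"

definition nord :: "V \<Rightarrow> int \<Rightarrow> V \<Rightarrow> int \<Rightarrow> V \<Rightarrow> V" where
  "nord a m b k v = (if m < 0 then aff a m (aff b k v) else aff b k (aff a m v))"

definition omegaF4 :: "nat \<Rightarrow> (nat \<Rightarrow> V) \<Rightarrow> (nat \<Rightarrow> V) \<Rightarrow> V" where
  "omegaF4 N u u' = scaleV (1 / 20)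
     (Sum_any (\<lambda>n::int. \<Sum>i<N. nord (u i) (- n) (u' i) (n - 2) vac))"

definition qv :: "nat \<Rightarrow> nat \<Rightarrow> V" where
  "qv i j = basisv (Poly_Mapping.single (i, 1) 1 + Poly_Mapping.single (j, 1) 1, 0)"

end

theory Submission
  imports Defs "HOL-Library.Product_Plus"
begin

text \<open>On the vacuum only the n = 1 summand survives, so the vector is 1/20 times the sum of
 u_i(-1) u'_i, i.e. the image of the Casimir tensor under a bilinear map. This tensor may be computed
 from any family w_k of elements of the fixed-point algebra with y = sum_k (w_k, y) w'_k for all its
 elements y, where w_k need not be independent and w'_k need not be fixed by the automorphism. With w'_k
 running through the root vectors and the fundamental weights, a root fixed by the automorphism
 contributes a multiple of its Heisenberg square, and a moved root x, being orthogonal to its image tx,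
 contributes in addition a signed multiple of e^(x - tx). What remains are finite sums over the 72
 roots.\<close>

declare Em.simps [simp del] Ep.simps [simp del]

subsection \<open>Linear maps on the Fock space\<close>

lemma sum_1_6: "(\<Sum>i\<in>{1..6::nat}. f i) = f 1 + f 2 + f 3 + f 4 + f 5 + (f 6 :: 'a::comm_monoid_add)"
proof -
  have "{1..6::nat} = {1,2,3,4,5,6}" by auto
  then show ?thesis by (simp add: ac_simps del: One_nat_def)
qed

lemma lookup_scaleV [simp]: "Poly_Mapping.lookup (scaleV c v) k = c * Poly_Mapping.lookup v k"
  unfolding scaleV_def by (cases "Poly_Mapping.lookup v k = 0") (auto simp: map.rep_eq when_def)

interpretation V: vector_space scaleV
  by unfold_locales (auto intro!: poly_mapping_eqI simp: lookup_add algebra_simps)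

abbreviation vlin :: "(V \<Rightarrow> V) \<Rightarrow> bool" where "vlin \<equiv> module_hom scaleV scaleV"

lemma vlinI: "(\<And>v w. f (v + w) = f v + f w) \<Longrightarrow> (\<And>c v. f (scaleV c v) = scaleV c (f v)) \<Longrightarrow> vlin f"
  by (simp add: module_hom_iff V.module_axioms)

text \<open>Keys outside the support carry coefficient 0. With the union of two supports as index
  set, additivity of \<open>lin\<close> becomes termwise.\<close>

lemma lin_superset:
  assumes "finite K" "Poly_Mapping.keys v \<subseteq> K"
  shows "lin T v = (\<Sum>k\<in>K. scaleV (Poly_Mapping.lookup v k) (T k))"
  unfolding lin_def using assms by (intro sum.mono_neutral_left) (auto simp: in_keys_iff)

lemma vlin_lin: "vlin (lin T)"
proof (rule vlinI)
  fix v w :: V and c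
  let ?K = "Poly_Mapping.keys v \<union> Poly_Mapping.keys w"
  have "Poly_Mapping.keys (v + w) \<subseteq> ?K" by (rule Poly_Mapping.keys_add)
  then show "lin T (v + w) = lin T v + lin T w"
    by (subst (1 2 3) lin_superset[of ?K])
       (auto simp: lookup_add V.scale_left_distrib sum.distrib)
  show "lin T (scaleV c v) = scaleV c (lin T v)"
    by (subst (1 2) lin_superset[of "Poly_Mapping.keys v"])
       (auto simp: V.scale_sum_right in_keys_iff)
qed

lemma lin_basisv [simp]: "lin T (basisv k) = T k"
  by (simp add: lin_def basisv_def)


lemma V_expand:
  assumes "finite K" "Poly_Mapping.keys v \<subseteq> K"
  shows "v = (\<Sum>k\<in>K. scaleV (Poly_Mapping.lookup v k) (basisv k))"
  using assms
  by (intro poly_mapping_eqI)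
     (auto simp: lookup_sum basisv_def lookup_single when_def in_keys_iff sum.delta' if_distrib cong: if_cong)

text \<open>For a fixed mode and argument, \<open>aff\<close> is itself an instance of
  \<open>lin\<close>.\<close>

lemma vlin_aff_left: "vlin (\<lambda>a. aff a k v)"
  unfolding aff_def using vlin_lin[of "\<lambda>key. mode_b key k v"] by (simp add: lin_def[abs_def])

lemma vlin_mode: "vlin (mode_b key k)"
  by (cases key) (auto simp: mode_b_def vop_def heis_def vlin_lin intro!: vlinI)

lemma aff_basisv [simp]: "aff (basisv key) k v = mode_b key k v"
  by (simp add: aff_def basisv_def)

lemma vlin_aff_right: "vlin (aff a k)"
  by (rule vlinI)
     (simp_all add: aff_def module_hom.add[OF vlin_mode] module_hom.scale[OF vlin_mode]
       V.scale_right_distrib sum.distrib V.scale_sum_right mult.commute)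

lemma module_hom_lookup: "module_hom scaleV (*) (\<lambda>v. Poly_Mapping.lookup v k)"
  by (auto simp: module_hom_iff V.module_axioms lookup_add module_def algebra_simps)

lemma module_hom_invform_left: "module_hom scaleV (*) (\<lambda>a. invform a b)"
  unfolding invform_def
  using module_hom_compose[OF vlin_aff_left module_hom_lookup] by (simp add: comp_def)

lemma module_hom_invform_right: "module_hom scaleV (*) (invform a)"
  unfolding invform_def[abs_def]
  using module_hom_compose[OF vlin_aff_right module_hom_lookup] by (simp add: comp_def)

text \<open>Both sides are images of one Casimir tensor. Each \<open>w k\<close> is expanded in the
  basis \<open>u\<close>, with coefficients \<open>F (w k) (u' i)\<close> by duality; after
  exchanging the sums, the frame identity at \<open>u' i\<close> reassembles \<open>u' i\<close> in
  the second slot of \<open>B\<close>.\<close>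

lemma casimir_change_of_frame:
  fixes B :: "V \<Rightarrow> V \<Rightarrow> V" and F :: "V \<Rightarrow> V \<Rightarrow> complex" and N :: nat
  assumes B1: "\<And>b. vlin (\<lambda>a. B a b)" and B2: "\<And>a. vlin (B a)"
    and F1: "\<And>b. module_hom scaleV (*) (\<lambda>a. F a b)"
    and u': "\<And>i. i < N \<Longrightarrow> u' i \<in> A"
    and dual: "\<And>i j. i < N \<Longrightarrow> j < N \<Longrightarrow> F (u i) (u' j) = (if i = j then 1 else 0)"
    and spans: "\<And>v. v \<in> A \<Longrightarrow> \<exists>c. v = (\<Sum>i<N. scaleV (c i) (u i))"
    and w: "\<And>k. k \<in> K \<Longrightarrow> w k \<in> A"
    and frame: "\<And>y. y \<in> A \<Longrightarrow> y = (\<Sum>k\<in>K. scaleV (F (w k) y) (w' k))"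
  shows "(\<Sum>i<N. B (u i) (u' i)) = (\<Sum>k\<in>K. B (w k) (w' k))"
proof -
  have expand: "v = (\<Sum>i<N. scaleV (F v (u' i)) (u i))" if "v \<in> A" for v
  proof -
    obtain c where c: "v = (\<Sum>i<N. scaleV (c i) (u i))" using spans \<open>v \<in> A\<close> by blast
    have "F v (u' j) = c j" if "j < N" for j
    proof -
      have "F v (u' j) = (\<Sum>i<N. c i * F (u i) (u' j))"
        unfolding c module_hom.sum[OF F1] module_hom.scale[OF F1] ..
      also have "\<dots> = (\<Sum>i<N. if i = j then c i else 0)"
        using that by (intro sum.cong) (auto simp: dual)
      finally show ?thesis using that by simp
    qed
    then show ?thesis by (subst c) (intro sum.cong, auto)
  qed
  have "(\<Sum>k\<in>K. B (w k) (w' k)) = (\<Sum>k\<in>K. B (\<Sum>i<N. scaleV (F (w k) (u' i)) (u i)) (w' k))"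
    using expand[OF w] by (intro sum.cong) auto
  also have "\<dots> = (\<Sum>k\<in>K. \<Sum>i<N. scaleV (F (w k) (u' i)) (B (u i) (w' k)))"
    by (simp add: module_hom.sum[OF B1] module_hom.scale[OF B1])
  also have "\<dots> = (\<Sum>i<N. \<Sum>k\<in>K. scaleV (F (w k) (u' i)) (B (u i) (w' k)))" by (rule sum.swap)
  also have "\<dots> = (\<Sum>i<N. B (u i) (\<Sum>k\<in>K. scaleV (F (w k) (u' i)) (w' k)))"
    by (simp add: module_hom.sum[OF B2] module_hom.scale[OF B2])
  also have "\<dots> = (\<Sum>i<N. B (u i) (u' i))"
    using frame[OF u'] by (intro sum.cong) auto
  finally show ?thesis ..
qed

section \<open>Heisenberg modes and vertex exponentials on the vacuum\<close>

lemma heis_neg_basisv: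
  assumes "0 < n"
  shows "heis h (- int n) (basisv (m, \<gamma>)) = (\<Sum>i\<in>{1..6}. scaleV (h i) (basisv (m + Poly_Mapping.single (i, n) 1, \<gamma>)))"
  using assms by (simp add: heis_def heis_b_def)

lemma vlin_heis: "vlin (heis h n)" unfolding heis_def by (rule vlin_lin)

text \<open>This is h(-n) applied to the vacuum, and \<open>fock2 h k\<close> below is h(-1)k(-1)
  applied to it.\<close>

definition fock1 :: "hvec \<Rightarrow> nat \<Rightarrow> V" where
  "fock1 h n = (\<Sum>i\<in>{1..6}. scaleV (h i) (basisv (Poly_Mapping.single (i, n) 1, 0)))"

definition fock2 :: "hvec \<Rightarrow> hvec \<Rightarrow> V" where
  "fock2 h k = (\<Sum>i\<in>{1..6}. \<Sum>j\<in>{1..6}. scaleV (h i * k j) (qv i j))"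

lemma heis_vac: "0 < n \<Longrightarrow> heis h (- int n) vac = fock1 h n"
  by (simp add: vac_def heis_neg_basisv fock1_def)

lemma heis_fock1: "heis h (-1) (fock1 k 1) = fock2 h k"
proof -
  have "heis h (-1) (fock1 k 1) = (\<Sum>j\<in>{1..6}. \<Sum>i\<in>{1..6}. scaleV (h i * k j) (qv i j))"
    using heis_neg_basisv[of 1 h]
    by (simp add: fock1_def module_hom.sum[OF vlin_heis] module_hom.scale[OF vlin_heis]
       V.scale_sum_right qv_def mult.commute add.commute del: One_nat_def)
  then show ?thesis unfolding fock2_def by (subst sum.swap)
qed

lemma Em_0: "Em h 0 v = v" by (subst Em.simps) simp
lemma Ep_0: "Ep h 0 v = v" by (subst Ep.simps) simp

text \<open>Order 2 is the one that occurs when mode -1 of e^(-alpha) meets e^alpha, since these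
  lattice vectors pair to -2 for a root alpha.\<close>

lemma Em_2_vac: "Em h 2 vac = scaleV (1/2) (fock2 h h + fock1 h 2)"
proof -
  have e1: "Em h 1 vac = fock1 h 1"
    by (subst Em.simps) (use heis_vac[of 1 h] in \<open>simp add: Em_0\<close>)
  have "{1..2::nat} = {1,2}" by auto
  then show ?thesis 
    by (subst Em.simps) (use heis_vac[of 2 h] e1 heis_fock1[of h h] in \<open>simp add: Em_0\<close>)
qed

text \<open>The vacuum has weight and charge 0: a vertex operator would need a negative order of
  \<open>Em\<close>, a positive Heisenberg mode finds no variable to remove, and the zero mode pairs
  with 0.\<close>

lemma nonneg_mode_vac:
  assumes "0 \<le> n" shows "aff a n vac = 0"
proof -
  have "mode_b key n vac = 0" for key
    using assms
    by (cases key) (auto simp: mode_b_def vop_def heis_def vop_b_def heis_b_def vac_def wt_def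
       ipair_def lform_def hform_def hv_of_lat_def)
  then show ?thesis by (simp add: aff_def)
qed

subsection \<open>The root lattice in simple root coordinates\<close>

declare One_nat_def [simp del]

text \<open>Coordinates in the simple roots; as integer tuples they let \<open>code_simp\<close>
  evaluate the finite sums over all roots.\<close>

type_synonym rcoords = "int \<times> int \<times> int \<times> int \<times> int \<times> int"

fun wcoords :: "rcoords \<Rightarrow> int list" where
  "wcoords (a, b, c, d, e, f) =
     [2*a - c, 2*b - d, 2*c - a - d, 2*d - b - c - e, 2*e - d - f, 2*f - e]"

definition rlat :: "rcoords \<Rightarrow> lat" where
  "rlat x = lat_of (\<lambda>j. wcoords x ! (j - 1))"

fun flip :: "rcoords \<Rightarrow> rcoords" where
  "flip (a, b, c, d, e, f) = (f, b, e, d, c, a)"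

fun cform :: "rcoords \<Rightarrow> rcoords \<Rightarrow> int" where
  "cform (a, b, c, d, e, f) (a', b', c', d', e', f') =
     (2*a - c)*a' + (2*b - d)*b' + (2*c - a - d)*c' + (2*d - b - c - e)*d' + (2*e - d - f)*e' + (2*f - e)*f'"

text \<open>There is one product for each of the five entries -1 of \<open>epsL\<close>.\<close>

fun cocycle_exponent :: "rcoords \<Rightarrow> rcoords \<Rightarrow> int" where
  "cocycle_exponent (a, b, c, d, e, f) (a', b', c', d', e', f') = a*c' + b*d' + c*d' + e*d' + f*e'"

definition cocycle_sign :: "rcoords \<Rightarrow> rcoords \<Rightarrow> int" where
  "cocycle_sign x y = (if even (cocycle_exponent x y) then 1 else -1)"

text \<open>The search prunes on partial sums of squares: eliminating the leaves of the Dynkin diagram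
 towards the branch node gives, for the coordinates a, ..., f of a lattice vector x,
 6 (x, x) = 3 (2f - e)^2 + 3 (2a - c)^2 + 3 (2b - d)^2 + (3e - 2d)^2 + (3c - 2d)^2 + d^2.\<close>

definition e6_coords :: "rcoords list" where
  "e6_coords = [(a, b, c, d, e, f).
     d \<leftarrow> [-3..3],
     c \<leftarrow> [-3..3], (3*c - 2*d)\<^sup>2 + d\<^sup>2 \<le> 12,
     e \<leftarrow> [-3..3], (3*e - 2*d)\<^sup>2 + (3*c - 2*d)\<^sup>2 + d\<^sup>2 \<le> 12,
     b \<leftarrow> [-2..2], 3*(2*b - d)\<^sup>2 + (3*e - 2*d)\<^sup>2 + (3*c - 2*d)\<^sup>2 + d\<^sup>2 \<le> 12,
     a \<leftarrow> [-2..2], 3*(2*a - c)\<^sup>2 + 3*(2*b - d)\<^sup>2 + (3*e - 2*d)\<^sup>2 + (3*c - 2*d)\<^sup>2 + d\<^sup>2 \<le> 12,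
     f \<leftarrow> [-2..2], 3*(2*f - e)\<^sup>2 + 3*(2*a - c)\<^sup>2 + 3*(2*b - d)\<^sup>2 + (3*e - 2*d)\<^sup>2 + (3*c - 2*d)\<^sup>2 + d\<^sup>2 = 12]"

lemma lookup_lat_of: "Poly_Mapping.lookup (lat_of f) j = (if j \<in> {1..6} then f j else 0)"
  by (simp add: lat_of_def lookup_sum lookup_single when_def)

lemma keys_lat_of: "Poly_Mapping.keys (lat_of f) \<subseteq> {1..6}"
  by (auto simp: in_keys_iff lookup_lat_of split: if_splits)

lemma lookup_rlat: "Poly_Mapping.lookup (rlat x) j = (if j \<in> {1..6} then wcoords x ! (j - 1) else 0)"
  by (simp add: rlat_def lookup_lat_of)

fun cnth :: "rcoords \<Rightarrow> nat \<Rightarrow> int" where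
  "cnth (a, b, c, d, e, f) j = [a, b, c, d, e, f] ! (j - 1)"

lemma cases_1_6:
  assumes "j \<in> {1..6::nat}"
  obtains "j = 1" | "j = 2" | "j = 3" | "j = 4" | "j = 5" | "j = 6"
  using assms by fastforce

text \<open>\<open>ginv\<close> is the inverse of the Cartan matrix that \<open>wcoords\<close>
  applies.\<close>

lemma rootc_rlat: "j \<in> {1..6} \<Longrightarrow> rootc (rlat x) j = of_int (cnth x j)"
  by (cases x; erule cases_1_6) (simp_all add: rootc_def sum_1_6 lookup_rlat ginv_def ginvL_def field_simps)

text \<open>Simple roots and fundamental weights are dual bases, so the form pairs the root
  coordinates of one vector with the weight coordinates of the other.\<close>

lemma lform_rlat: "lform (rlat x) (rlat y) = of_int (cform x y)"
proof -
  have "lform (rlat x) (rlat y) = (\<Sum>j\<in>{1..6}. rootc (rlat x) j * of_int (Poly_Mapping.lookup (rlat y) j))"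
    unfolding lform_def rootc_def sum_distrib_right by (rule sum.swap)
  also have "\<dots> = (\<Sum>j\<in>{1..6}. of_int (cnth x j) * of_int (Poly_Mapping.lookup (rlat y) j))"
    by (intro sum.cong) (auto simp: rootc_rlat)
  finally show ?thesis
    by (cases x; cases y) (simp add: sum_1_6 lookup_rlat algebra_simps)
qed

lemma ipair_rlat: "ipair (rlat x) (rlat y) = cform x y"
  by (simp add: ipair_def lform_rlat)

lemma rlat_in_Q_lat: "rlat x \<in> Q_lat"
  using keys_lat_of[of "\<lambda>j. wcoords x ! (j - 1)"]
  by (auto simp: Q_lat_def P_lat_def rootc_rlat rlat_def[symmetric])

lemma cocycle_rlat: "cocycle (rlat x) (rlat y) = of_int (cocycle_sign x y)"
proof -
  have "(\<Sum>i\<in>{1..6}. \<Sum>j\<in>{1..6}. if epsL ! (i - 1) ! (j - 1) = -1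
          then \<lfloor>rootc (rlat x) i\<rfloor> * \<lfloor>rootc (rlat y) j\<rfloor> else 0) = cocycle_exponent x y"
    by (cases x; cases y) (simp add: sum_1_6 rootc_rlat epsL_def)
  then show ?thesis
    by (simp add: cocycle_def rlat_in_Q_lat cocycle_sign_def minus_one_power_iff even_nat_iff)
qed

text \<open>The root coordinates are integral by definition of \<open>Q_lat\<close>, so taking
  floors loses nothing, and the Cartan matrix carries them back to the weight coordinates.\<close>

lemma Q_latE:
  assumes "\<gamma> \<in> Q_lat" obtains x where "\<gamma> = rlat x"
proof
  define g where "g j = (of_int (Poly_Mapping.lookup \<gamma> j) :: rat)" for j
  have rc: "of_int \<lfloor>rootc \<gamma> j\<rfloor> = (\<Sum>k\<in>{1..6}. g k * ginv k j)" if "j \<in> {1..6}" for j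
    using assms that unfolding g_def Q_lat_def rootc_def[symmetric] by auto
  let ?x = "(\<lfloor>rootc \<gamma> 1\<rfloor>, \<lfloor>rootc \<gamma> 2\<rfloor>, \<lfloor>rootc \<gamma> 3\<rfloor>, \<lfloor>rootc \<gamma> 4\<rfloor>, \<lfloor>rootc \<gamma> 5\<rfloor>, \<lfloor>rootc \<gamma> 6\<rfloor>)"
  have "of_int (wcoords ?x ! (j - 1)) = g j" if "j \<in> {1..6}" for j
    using that by (cases rule: cases_1_6) (simp_all add: rc sum_1_6 ginv_def ginvL_def field_simps)
  then have "wcoords ?x ! (j - 1) = Poly_Mapping.lookup \<gamma> j" if "j \<in> {1..6}" for j
    using that unfolding g_def by (simp only: of_int_eq_iff)
  moreover have "Poly_Mapping.lookup \<gamma> j = 0" if "j \<notin> {1..6}" for j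
    using assms that by (auto simp: Q_lat_def P_lat_def in_keys_iff)
  ultimately show "\<gamma> = rlat ?x" by (intro poly_mapping_eqI) (auto simp: lookup_rlat simp del: wcoords.simps)
qed

lemma inj_rlat: "inj rlat"
proof (rule injI)
  fix x y assume "rlat x = rlat y"
  then have "cnth x j = cnth y j" if "j \<in> {1..6}" for j
    using rootc_rlat[OF that, of x] rootc_rlat[OF that, of y] by simp
  from this[of 1] this[of 2] this[of 3] this[of 4] this[of 5] this[of 6] show "x = y"
    by (cases x; cases y) simp
qed

lemma e6_coords_iff: "x \<in> set e6_coords \<longleftrightarrow> cform x x = 2"
proof -
  obtain a b c d e f where x: "x = (a, b, c, d, e, f)" by (cases x)
  have sq: "6 * cform x x = 3*(2*f - e)\<^sup>2 + 3*(2*a - c)\<^sup>2 + 3*(2*b - d)\<^sup>2 + (3*e - 2*d)\<^sup>2 + (3*c - 2*d)\<^sup>2 + d\<^sup>2"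
    by (simp add: x power2_eq_square algebra_simps)
  \<comment> \<open>A larger absolute value would have square at least 16.\<close>
  have bound: "\<bar>t\<bar> \<le> 3" if "t\<^sup>2 \<le> 12" for t :: int
    using power2_le_iff_abs_le[of 4 t] abs_le_square_iff[of 4 t] that by fastforce
  have bound': "\<bar>t\<bar> \<le> 2" if "3 * t\<^sup>2 \<le> 12" for t :: int
    using power2_le_iff_abs_le[of 2 t] that by simp
  show ?thesis
  proof
    assume "x \<in> set e6_coords"
    then have "6 * cform x x = 12" unfolding sq by (auto simp: x e6_coords_def simp del: upto_rec_numeral)
    then show "cform x x = 2" by simp
  next
    assume "cform x x = 2"
    then have E: "3*(2*f - e)\<^sup>2 + 3*(2*a - c)\<^sup>2 + 3*(2*b - d)\<^sup>2 + (3*e - 2*d)\<^sup>2 + (3*c - 2*d)\<^sup>2 + d\<^sup>2 = 12"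
      using sq by simp
    note nn = zero_le_power2[of "2*f-e"] zero_le_power2[of "2*a-c"] zero_le_power2[of "2*b-d"]
       zero_le_power2[of "3*e-2*d"] zero_le_power2[of "3*c-2*d"] zero_le_power2[of d]
    have "\<bar>d\<bar> \<le> 3" "\<bar>3*c - 2*d\<bar> \<le> 3" "\<bar>3*e - 2*d\<bar> \<le> 3" by (rule bound, use E nn in linarith)+
    moreover have "\<bar>2*b - d\<bar> \<le> 2" "\<bar>2*a - c\<bar> \<le> 2" "\<bar>2*f - e\<bar> \<le> 2"
      by (rule bound', use E nn in linarith)+
    \<comment> \<open>The search ranges come from 3|c| <= 3 + 2|d| <= 9, likewise for e, and from
      2|b| <= 2 + |d| <= 5, likewise for a and f.\<close>
    ultimately have "d \<in> {-3..3}" "c \<in> {-3..3}" "e \<in> {-3..3}" "b \<in> {-2..2}" "a \<in> {-2..2}" "f \<in> {-2..2}"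
      by auto
    moreover have "3*(2*a - c)\<^sup>2 + 3*(2*b - d)\<^sup>2 + (3*e - 2*d)\<^sup>2 + (3*c - 2*d)\<^sup>2 + d\<^sup>2 \<le> 12"
      "3*(2*b - d)\<^sup>2 + (3*e - 2*d)\<^sup>2 + (3*c - 2*d)\<^sup>2 + d\<^sup>2 \<le> 12"
      "(3*e - 2*d)\<^sup>2 + (3*c - 2*d)\<^sup>2 + d\<^sup>2 \<le> 12" "(3*c - 2*d)\<^sup>2 + d\<^sup>2 \<le> 12"
      using E nn by linarith+
    ultimately show "x \<in> set e6_coords"
      using E by (simp add: x e6_coords_def del: upto_rec_numeral)
  qed
qed

lemma E6roots_eq: "E6roots = rlat ` set e6_coords"
proof -
  have "\<gamma> \<in> E6roots \<longleftrightarrow> \<gamma> \<in> rlat ` set e6_coords" for \<gamma>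
    by (auto simp: E6roots_def e6_coords_iff lform_rlat rlat_in_Q_lat simp del: cform.simps elim!: Q_latE)
  then show ?thesis by blast
qed

subsection \<open>The diagram automorphism and the invariant form\<close>

text \<open>Serves the automorphism on all three levels: lattice vectors, monomials and the whole
  space are each relabelled by an involution.\<close>

lemma lookup_sum_single_involution:
  fixes f :: "'a \<Rightarrow>\<^sub>0 'b::comm_monoid_add"
  assumes "\<And>x. p (p x) = x"
  shows "Poly_Mapping.lookup (\<Sum>i\<in>Poly_Mapping.keys f. Poly_Mapping.single (p i) (Poly_Mapping.lookup f i)) j
     = Poly_Mapping.lookup f (p j)"
proof -
  have "p i = j \<longleftrightarrow> i = p j" for i using assms by metis
  then show ?thesis
    by (simp add: lookup_sum lookup_single when_def in_keys_iff)
qed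

lemma tperm_tperm [simp]: "tperm (tperm i) = i"
  by (simp add: tperm_def)

lemma tperm_in [simp]: "tperm i \<in> {1..6} \<longleftrightarrow> i \<in> {1..6}"
  by (auto simp: tperm_def split: if_splits)

lemma lookup_tau_lat: "Poly_Mapping.lookup (tau_lat \<gamma>) j = Poly_Mapping.lookup \<gamma> (tperm j)"
  unfolding tau_lat_def by (rule lookup_sum_single_involution) simp

lemma lookup_tau_mono: "Poly_Mapping.lookup (tau_mono m) k = Poly_Mapping.lookup m (tperm (fst k), snd k)"
  unfolding tau_mono_def by (rule lookup_sum_single_involution) simp

definition tau_key :: "mono \<times> lat \<Rightarrow> mono \<times> lat" where
  "tau_key k = (tau_mono (fst k), tau_lat (snd k))"

lemma tau_key_tau_key: "tau_key (tau_key k) = k"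
  by (cases k) (auto simp: tau_key_def lookup_tau_lat lookup_tau_mono intro!: poly_mapping_eqI)

lemma tauV_eq: "tauV = lin (\<lambda>k. basisv (tau_key k))"
  unfolding tauV_def tau_key_def by (simp add: case_prod_unfold)

lemma vlin_tauV: "vlin tauV"
  unfolding tauV_eq by (rule vlin_lin)

lemma tauV_basisv: "tauV (basisv k) = basisv (tau_key k)"
  by (simp add: tauV_eq)

lemma lookup_tauV: "Poly_Mapping.lookup (tauV v) k = Poly_Mapping.lookup v (tau_key k)"
proof -
  have "tauV v = (\<Sum>i\<in>Poly_Mapping.keys v. Poly_Mapping.single (tau_key i) (Poly_Mapping.lookup v i))"
    unfolding tauV_eq lin_def
    by (intro sum.cong refl poly_mapping_eqI) (simp add: basisv_def lookup_single when_def)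
  then show ?thesis by (simp add: lookup_sum_single_involution tau_key_tau_key)
qed

lemma wcoords_flip: "j \<in> {1..6} \<Longrightarrow> wcoords (flip x) ! (j - 1) = wcoords x ! (tperm j - 1)"
  by (cases x; erule cases_1_6) (simp_all add: tperm_def)

lemma tau_lat_rlat: "tau_lat (rlat x) = rlat (flip x)"
  by (intro poly_mapping_eqI) (simp add: lookup_tau_lat lookup_rlat wcoords_flip del: wcoords.simps atLeastAtMost_iff)

lemma tau_mono_0: "tau_mono 0 = 0"
  by (simp add: tau_mono_def)

lemma tau_key_heis: "tau_key (Poly_Mapping.single (j, n) 1, 0) = (Poly_Mapping.single (tperm j, n) 1, 0)"
proof -
  have "(j, n) = (tperm (fst k), snd k) \<longleftrightarrow> (tperm j, n) = k" for k :: "nat \<times> nat"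
    by (cases k) (metis fst_conv snd_conv tperm_tperm)
  then show ?thesis
    by (auto simp: tau_key_def lookup_tau_lat lookup_tau_mono lookup_single when_def intro!: poly_mapping_eqI)
qed

lemma wcoords_diff: "j \<in> {1..6} \<Longrightarrow> wcoords (x - y) ! (j - 1) = wcoords x ! (j - 1) - wcoords y ! (j - 1)"
  by (cases x; cases y; erule cases_1_6) simp_all

lemma rlat_diff: "rlat (x - y) = rlat x - rlat y"
  by (intro poly_mapping_eqI) (simp add: lookup_rlat lookup_minus wcoords_diff del: wcoords.simps)

lemma rlat_0: "rlat 0 = 0"
  using rlat_diff[of 0 0] by simp

lemma rlat_minus: "rlat (- x) = - rlat x"
  using rlat_diff[of 0 x] by (simp add: rlat_0)

lemma cform_flip: "cform (flip x) (flip y) = cform x y"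
  by (cases x; cases y) (simp add: algebra_simps)

lemma cform_minus: "cform (- x) y = - cform x y" "cform x (- y) = - cform x y"
  by (cases x; cases y; simp add: algebra_simps)+

text \<open>This is the invariance of the cocycle under the automorphism: \<open>flip\<close>
  exchanges the exponent terms for the index pairs (1,3) and (6,5), and those for (3,4) and
  (5,4).\<close>

lemma cocycle_sign_flip: "cocycle_sign (flip x) (flip y) = cocycle_sign x y"
  by (cases x; cases y) (simp add: algebra_simps cocycle_sign_def)

lemma cocycle_sign_minus: "cocycle_sign (- x) y = cocycle_sign x y" "cocycle_sign x (- y) = cocycle_sign x y"
proof -
  have "cocycle_exponent (- x) y = - cocycle_exponent x y" "cocycle_exponent x (- y) = - cocycle_exponent x y"
    by (cases x; cases y; simp add: algebra_simps)+
  then show "cocycle_sign (- x) y = cocycle_sign x y" "cocycle_sign x (- y) = cocycle_sign x y" by (simp_all add: cocycle_sign_def)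
qed

lemma flip_flip: "flip (flip x) = x"
  by (cases x) simp

lemma flip_minus: "flip (- x) = - flip x"
  by (cases x) simp

lemma minus_in_e6_coords: "- x \<in> set e6_coords \<longleftrightarrow> x \<in> set e6_coords"
  by (simp add: e6_coords_iff cform_minus)

lemma flip_in_e6_coords: "flip x \<in> set e6_coords \<longleftrightarrow> x \<in> set e6_coords"
  by (simp add: e6_coords_iff cform_flip)

section \<open>The basis of the Lie algebra and its coordinates\<close>

definition hkey :: "nat \<Rightarrow> mono \<times> lat" where
  "hkey j = (Poly_Mapping.single (j, 1) 1, 0)"

definition rkey :: "rcoords \<Rightarrow> mono \<times> lat" where
  "rkey x = (0, rlat x)"

lemma tau_rkey: "tau_key (rkey x) = rkey (flip x)"
  by (simp add: rkey_def tau_key_def tau_lat_rlat tau_mono_0)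

lemma tau_hkey: "tau_key (hkey j) = hkey (tperm j)"
  by (simp add: hkey_def tau_key_heis)

lemma inj_rkey: "inj rkey"
  using inj_rlat by (auto simp: rkey_def inj_on_def)

lemma single_one_eq_iff: "Poly_Mapping.single a (1::nat) = Poly_Mapping.single b 1 \<longleftrightarrow> a = b"
  by (metis lookup_single_eq lookup_single_not_eq one_neq_zero)

lemma single_one_neq_0: "Poly_Mapping.single a (1::nat) \<noteq> 0"
  by (metis lookup_single_eq lookup_zero one_neq_zero)

lemma inj_hkey: "inj hkey"
  by (auto simp: hkey_def inj_on_def single_one_eq_iff)

lemma rkey_neq_hkey: "rkey x \<noteq> hkey j" "hkey j \<noteq> rkey x"
  by (auto simp: rkey_def hkey_def single_one_neq_0 dest: sym)

lemma gkeys_eq: "gkeys = rkey ` set e6_coords \<union> hkey ` {1..6}"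
  unfolding gkeys_def E6roots_eq rkey_def hkey_def by blast

lemma finite_gkeys: "finite gkeys" by (simp add: gkeys_eq)

lemma gE6_expand:
  assumes "y \<in> gE6"
  shows "y = (\<Sum>x\<in>set e6_coords. scaleV (Poly_Mapping.lookup y (rkey x)) (basisv (rkey x)))
     + (\<Sum>j\<in>{1..6}. scaleV (Poly_Mapping.lookup y (hkey j)) (basisv (hkey j)))"
proof -
  have "y = (\<Sum>k\<in>gkeys. scaleV (Poly_Mapping.lookup y k) (basisv k))"
    using assms by (intro V_expand finite_gkeys) (simp add: gE6_def)
  also have "\<dots> = (\<Sum>k\<in>rkey ` set e6_coords. scaleV (Poly_Mapping.lookup y k) (basisv k))
     + (\<Sum>k\<in>hkey ` {1..6}. scaleV (Poly_Mapping.lookup y k) (basisv k))"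
    unfolding gkeys_eq by (rule sum.union_disjoint) (use rkey_neq_hkey in auto)
  finally show ?thesis
    by (simp add: sum.reindex inj_on_subset[OF inj_rkey] inj_on_subset[OF inj_hkey])
qed

lemma aF4_lookup_flip:
  assumes "y \<in> aF4" shows "Poly_Mapping.lookup y (rkey (flip x)) = Poly_Mapping.lookup y (rkey x)"
  using lookup_tauV[of y "rkey x"] assms by (simp add: aF4_def tau_rkey)

lemma aF4_lookup_tperm:
  assumes "y \<in> aF4" shows "Poly_Mapping.lookup y (hkey (tperm j)) = Poly_Mapping.lookup y (hkey j)"
  using lookup_tauV[of y "hkey j"] assms by (simp add: aF4_def tau_hkey)

lemma mode_rkey: "mode_b (rkey x) k = vop (rlat x) k"
  by (simp add: mode_b_def rkey_def)

lemma mode_hkey: "j \<in> {1..6} \<Longrightarrow> mode_b (hkey j) k = heis (fwv j) k"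
proof -
  assume j: "j \<in> {1..6}"
  have "(\<lambda>i. of_nat (Poly_Mapping.lookup (Poly_Mapping.single (j, 1::nat) (1::nat)) (i, 1))) = fwv j"
    by (auto simp: fwv_def lookup_single when_def)
  then show ?thesis
    using j by (auto simp: mode_b_def hkey_def single_one_neq_0)
qed

text \<open>The grading by lattice degree makes the pairing of two root vectors vanish unless the
 roots are opposite, without having to know that the form takes values at least -1 there.\<close>

definition in_charge :: "lat \<Rightarrow> V \<Rightarrow> bool" where
  "in_charge \<gamma> v \<longleftrightarrow> (\<forall>k\<in>Poly_Mapping.keys v. snd k = \<gamma>)"

lemma in_charge_iff: "in_charge \<gamma> v \<longleftrightarrow> (\<forall>m \<delta>. \<delta> \<noteq> \<gamma> \<longrightarrow> Poly_Mapping.lookup v (m, \<delta>) = 0)"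
  unfolding in_charge_def by (metis in_keys_iff prod.collapse snd_conv)

lemma in_charge_sum: "(\<And>i. i \<in> I \<Longrightarrow> in_charge \<gamma> (f i)) \<Longrightarrow> in_charge \<gamma> (\<Sum>i\<in>I. f i)"
  by (simp add: in_charge_iff lookup_sum)

lemma in_charge_scaleV: "in_charge \<gamma> v \<Longrightarrow> in_charge \<gamma> (scaleV c v)"
  by (simp add: in_charge_iff)

lemma in_charge_basisv: "in_charge \<gamma> (basisv (m, \<gamma>))"
  by (auto simp: in_charge_def basisv_def)

lemma in_charge_heis: "in_charge \<gamma> v \<Longrightarrow> in_charge \<gamma> (heis h n v)"
  unfolding heis_def lin_def
  by (intro in_charge_sum in_charge_scaleV)
     (auto simp: heis_b_def in_charge_def[of _ v] intro!: in_charge_sum in_charge_scaleV in_charge_basisv)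

lemma in_charge_Em: "in_charge \<gamma> v \<Longrightarrow> in_charge \<gamma> (Em h p v)"
proof (induction p rule: less_induct)
  case (less p)
  then show ?case
    by (subst Em.simps) (auto intro!: in_charge_scaleV in_charge_sum in_charge_heis)
qed

text \<open>A pure exponential has weight 0, so only the order 0 term of \<open>Ep\<close> occurs
  and a single coefficient of \<open>Em\<close> is left.\<close>

lemma vop_estate:
  "vop \<alpha> k (estate \<beta>) = scaleV (cocycle \<alpha> \<beta>)
     (if 0 \<le> - k - 1 - ipair \<alpha> \<beta> then Em (hv_of_lat \<alpha>) (nat (- k - 1 - ipair \<alpha> \<beta>)) (estate (\<alpha> + \<beta>)) else 0)"
  by (simp add: vop_def estate_def vop_b_def wt_def Ep_0)

lemma basisv_rkey: "basisv (rkey x) = estate (rlat x)"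
  by (simp add: rkey_def estate_def)

text \<open>The state has weight 1, so q is at most 1 and the order q - 2 required of
  \<open>Em\<close> is negative.\<close>

lemma vop_hkey_1: "vop \<alpha> 1 (basisv (hkey j)) = 0"
proof -
  have "ipair \<alpha> 0 = 0" by (simp add: ipair_def lform_def)
  moreover have "wt (Poly_Mapping.single (j, 1) 1) = 1" by (simp add: wt_def)
  moreover have "{0..1::nat} = {0, 1}" by auto
  ultimately show ?thesis by (simp add: vop_def vop_b_def hkey_def)
qed

lemma vac_eq: "vac = estate 0" by (simp add: vac_def estate_def)

lemma invform_rkey_rkey:
  assumes "x \<in> set e6_coords"
  shows "invform (basisv (rkey x)) (basisv (rkey y)) = (if y = - x then of_int (cocycle_sign x x) else 0)"
proof (cases "y = - x")
  case True
  have "invform (basisv (rkey x)) (basisv (rkey (- x))) = Poly_Mapping.lookup (vop (rlat x) 1 (estate (rlat (- x)))) (0, 0)"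
    by (simp add: invform_def mode_rkey flip: basisv_rkey)
  also have "\<dots> = of_int (cocycle_sign x x) * Poly_Mapping.lookup (estate 0) (0, 0)"
    \<comment> \<open>Opposite roots pair to -2, so the order of \<open>Em\<close> is -1 - 1 + 2 =
      0.\<close>
    using assms by (simp add: vop_estate cocycle_rlat cocycle_sign_minus ipair_rlat cform_minus e6_coords_iff Em_0) (simp add: rlat_minus)
  finally show ?thesis using True by (simp add: estate_def basisv_def)
next
  case False
  then have "rlat x + rlat y \<noteq> 0"
    using inj_rlat rlat_minus[of x] by (metis add_eq_0_iff inj_def)
  moreover have "in_charge (rlat x + rlat y) (Em (hv_of_lat (rlat x)) p (estate (rlat x + rlat y)))" for p
    unfolding estate_def by (intro in_charge_Em in_charge_basisv)
  ultimately show ?thesis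
    using False by (simp add: invform_def mode_rkey basisv_rkey[of y] vop_estate in_charge_iff)
qed

lemma invform_rkey_hkey: "invform (basisv (rkey x)) (basisv (hkey j)) = 0"
  by (simp add: invform_def mode_rkey vop_hkey_1)

lemma heis_1_estate: "heis h 1 (estate \<gamma>) = 0"
  by (simp add: heis_def estate_def heis_b_def)

lemma invform_hkey_rkey: "i \<in> {1..6} \<Longrightarrow> invform (basisv (hkey i)) (basisv (rkey y)) = 0"
  by (simp add: invform_def mode_hkey basisv_rkey[of y] heis_1_estate)

lemma hform_fwv: "i \<in> {1..6} \<Longrightarrow> j \<in> {1..6} \<Longrightarrow> hform (fwv i) (fwv j) = of_rat (ginv i j)"
proof -
  assume "i \<in> {1..6}" "j \<in> {1..6}"
  have "hform (fwv i) (fwv j) = (\<Sum>k\<in>{1..6}. \<Sum>l\<in>{1..6}. if l = j then if k = i then of_rat (ginv i j) else 0 else 0)"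
    unfolding hform_def fwv_def by (intro sum.cong refl) auto
  then show ?thesis using \<open>i \<in> {1..6}\<close> \<open>j \<in> {1..6}\<close> by simp
qed

lemma heis_1_hkey:
  assumes "j \<in> {1..6}" shows "heis h 1 (basisv (hkey j)) = scaleV (hform h (fwv j)) vac"
proof -
  have "heis h 1 (basisv (hkey j)) = (\<Sum>i\<in>{1..6}. if i = j then scaleV (hform h (fwv j)) vac else 0)"
    unfolding heis_def hkey_def lin_basisv heis_b_def vac_def
    by (auto simp: lookup_single when_def One_nat_def simp del: sum.delta sum.delta' intro!: sum.cong)
  then show ?thesis using assms by simp
qed

lemma lookup_vac: "Poly_Mapping.lookup vac (0, 0) = 1"
  by (simp add: vac_def basisv_def)

lemma invform_hkey_hkey:
  "i \<in> {1..6} \<Longrightarrow> j \<in> {1..6} \<Longrightarrow> invform (basisv (hkey i)) (basisv (hkey j)) = of_rat (ginv i j)"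
  by (simp add: invform_def mode_hkey heis_1_hkey hform_fwv lookup_vac)

lemmas invform_left = module_hom.sum[OF module_hom_invform_left] module_hom.scale[OF module_hom_invform_left]
   module_hom.add[OF module_hom_invform_left]
lemmas invform_right = module_hom.sum[OF module_hom_invform_right] module_hom.scale[OF module_hom_invform_right]
   module_hom.add[OF module_hom_invform_right]

lemma invform_rkey:
  assumes "x \<in> set e6_coords" "y \<in> gE6"
  shows "invform (basisv (rkey x)) y = of_int (cocycle_sign x x) * Poly_Mapping.lookup y (rkey (- x))"
proof -
  have "invform (basisv (rkey x)) y = (\<Sum>z\<in>set e6_coords. if z = - x
      then of_int (cocycle_sign x x) * Poly_Mapping.lookup y (rkey (- x)) else 0)"
    unfolding arg_cong[OF gE6_expand[OF assms(2)], of "invform (basisv (rkey x))"]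
    unfolding invform_right invform_rkey_hkey
    by (auto simp: invform_rkey_rkey assms(1) simp del: sum.delta sum.delta' intro!: sum.cong)
  then show ?thesis using assms(1) by (simp add: minus_in_e6_coords)
qed

lemma invform_hkey:
  assumes "i \<in> {1..6}" "y \<in> gE6"
  shows "invform (basisv (hkey i)) y = (\<Sum>j\<in>{1..6}. of_rat (ginv i j) * Poly_Mapping.lookup y (hkey j))"
proof -
  have "invform (basisv (hkey i)) y = (\<Sum>j\<in>{1..6}. Poly_Mapping.lookup y (hkey j) * invform (basisv (hkey i)) (basisv (hkey j)))"
    unfolding arg_cong[OF gE6_expand[OF assms(2)], of "invform (basisv (hkey i))"]
    by (simp add: invform_right invform_hkey_rkey assms del: atLeastAtMost_iff)
  also have "\<dots> = (\<Sum>j\<in>{1..6}. of_rat (ginv i j) * Poly_Mapping.lookup y (hkey j))"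
    using assms by (intro sum.cong) (auto simp: invform_hkey_hkey)
  finally show ?thesis .
qed

text \<open>Elements of the fixed-point algebra that represent, under the invariant form, the coordinate
 functionals at the keys of all 72 roots and 6 weights. They are linearly dependent, but every
 expansion is uniform and no orbit representatives have to be chosen.\<close>

definition rframe :: "rcoords \<Rightarrow> V" where
  "rframe x = scaleV (of_int (cocycle_sign x x) / 2) (basisv (rkey (- x)) + basisv (rkey (- flip x)))"

text \<open>The Cartan matrix expresses simple roots in fundamental weights, so this is the average
  of alpha_j(-1) and its image under the automorphism.\<close>

definition hframe :: "nat \<Rightarrow> V" where
  "hframe j = (\<Sum>i\<in>{1..6}. scaleV (of_int (cartan i j + cartan i (tperm j)) / 2) (basisv (hkey i)))"

text \<open>The two halves read the coefficients of \<open>y\<close> at \<open>x\<close> and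
  \<open>flip x\<close>, which agree on a fixed vector; the sign in \<open>rframe\<close> cancels
  the one in the form.\<close>

lemma invform_rframe:
  assumes "x \<in> set e6_coords" "y \<in> aF4"
  shows "invform (rframe x) y = Poly_Mapping.lookup y (rkey x)"
proof -
  have "y \<in> gE6" using assms by (simp add: aF4_def)
  then show ?thesis
    using assms
    by (simp add: rframe_def invform_left invform_rkey minus_in_e6_coords flip_in_e6_coords cocycle_sign_minus
        cocycle_sign_flip aF4_lookup_flip) (simp add: cocycle_sign_def)
qed

lemma cartan_ginv:
  assumes "i \<in> {1..6}" "j \<in> {1..6}"
  shows "(\<Sum>k\<in>{1..6}. of_int (cartan k i) * ginv k j) = (if i = j then 1 else 0)"
  using assms(1)
  by (cases rule: cases_1_6; cases rule: cases_1_6[OF assms(2)])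
     (simp_all add: sum_1_6 cartan_def cartanL_def ginv_def ginvL_def)

lemma invform_hframe:
  assumes "j \<in> {1..6}" "y \<in> aF4"
  shows "invform (hframe j) y = Poly_Mapping.lookup y (hkey j)"
proof -
  have y: "y \<in> gE6" using assms by (simp add: aF4_def)
  \<comment> \<open>Pairing with alpha_i extracts the coefficient of lambda_i by duality.\<close>
  have *: "(\<Sum>k\<in>{1..6}. of_int (cartan k i) * invform (basisv (hkey k)) y) = Poly_Mapping.lookup y (hkey i)"
    if "i \<in> {1..6}" for i
  proof -
    have "(\<Sum>k\<in>{1..6}. of_int (cartan k i) * invform (basisv (hkey k)) y)
       = (\<Sum>k\<in>{1..6}. \<Sum>l\<in>{1..6}. of_int (cartan k i) * of_rat (ginv k l) * Poly_Mapping.lookup y (hkey l))"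
      by (intro sum.cong refl) (simp add: invform_hkey y sum_distrib_left mult.assoc del: atLeastAtMost_iff)
    also have "\<dots> = (\<Sum>l\<in>{1..6}. of_rat (\<Sum>k\<in>{1..6}. of_int (cartan k i) * ginv k l) * Poly_Mapping.lookup y (hkey l))"
      by (subst sum.swap) (simp add: of_rat_sum of_rat_mult sum_distrib_right)
    also have "\<dots> = (\<Sum>l\<in>{1..6}. if l = i then Poly_Mapping.lookup y (hkey l) else 0)"
      using that by (intro sum.cong refl) (auto simp add: cartan_ginv simp del: atLeastAtMost_iff)
    finally show ?thesis using that by simp
  qed
  have "invform (hframe j) y = ((\<Sum>k\<in>{1..6}. of_int (cartan k j) * invform (basisv (hkey k)) y)
      + (\<Sum>k\<in>{1..6}. of_int (cartan k (tperm j)) * invform (basisv (hkey k)) y)) / 2"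
    by (simp add: hframe_def invform_left sum.distrib[symmetric] sum_divide_distrib distrib_right)
  also have "\<dots> = Poly_Mapping.lookup y (hkey j)"
    using * assms by (simp add: aF4_lookup_tperm del: atLeastAtMost_iff)
  finally show ?thesis .
qed

lemma gE6_sum: "(\<And>i. i \<in> I \<Longrightarrow> f i \<in> gE6) \<Longrightarrow> (\<Sum>i\<in>I. f i) \<in> gE6"
  using keys_sum[of f I] by (fastforce simp: gE6_def)

lemma gE6_add: "v \<in> gE6 \<Longrightarrow> w \<in> gE6 \<Longrightarrow> v + w \<in> gE6"
  using keys_add[of v w] by (auto simp: gE6_def)

lemma gE6_scaleV: "v \<in> gE6 \<Longrightarrow> scaleV c v \<in> gE6"
  by (auto simp: gE6_def in_keys_iff)

lemma gE6_basisv: "k \<in> gkeys \<Longrightarrow> basisv k \<in> gE6"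
  by (simp add: gE6_def basisv_def)

lemma rframe_in_aF4: "x \<in> set e6_coords \<Longrightarrow> rframe x \<in> aF4"
  by (auto simp: aF4_def rframe_def module_hom.add[OF vlin_tauV] module_hom.scale[OF vlin_tauV] tauV_basisv
     tau_rkey flip_minus flip_flip add.commute gkeys_eq minus_in_e6_coords flip_in_e6_coords
     intro!: gE6_scaleV gE6_add gE6_basisv)

lemma cartan_tperm: "i \<in> {1..6} \<Longrightarrow> j \<in> {1..6} \<Longrightarrow> cartan (tperm i) (tperm j) = cartan i j"
  by (erule cases_1_6; erule cases_1_6) (simp_all add: cartan_def cartanL_def tperm_def)

text \<open>After reindexing by \<open>tperm\<close>, invariance of the Cartan matrix merely swaps
  the two summands of each coefficient.\<close>

lemma hframe_in_aF4:
  assumes "j \<in> {1..6}" shows "hframe j \<in> aF4"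
proof -
  have "tauV (hframe j) = (\<Sum>i\<in>{1..6}. scaleV (of_int (cartan i j + cartan i (tperm j)) / 2) (basisv (hkey (tperm i))))"
    by (simp add: hframe_def module_hom.sum[OF vlin_tauV] module_hom.scale[OF vlin_tauV] tauV_basisv tau_hkey)
  also have "\<dots> = (\<Sum>i\<in>{1..6}. scaleV (of_int (cartan (tperm i) j + cartan (tperm i) (tperm j)) / 2) (basisv (hkey i)))"
    by (rule sum.reindex_bij_witness[of _ tperm tperm]) (auto simp del: atLeastAtMost_iff)
  also have "\<dots> = hframe j"
    unfolding hframe_def
  proof (intro sum.cong refl)
    fix i :: nat assume "i \<in> {1..6}"
    then show "scaleV (of_int (cartan (tperm i) j + cartan (tperm i) (tperm j)) / 2) (basisv (hkey i))
       = scaleV (of_int (cartan i j + cartan i (tperm j)) / 2) (basisv (hkey i))"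
      using cartan_tperm[of i j] cartan_tperm[of i "tperm j"] assms by (simp del: atLeastAtMost_iff add: add.commute)
  qed
  finally have "tauV (hframe j) = hframe j" .
  then show ?thesis
    by (auto simp: aF4_def) (auto simp: hframe_def gkeys_eq intro!: gE6_sum gE6_scaleV gE6_basisv)
qed

subsection \<open>Evaluation of the Casimir sum\<close>

text \<open>Allows list sums, which can be evaluated, to be read as sums over the set of
  roots.\<close>

lemma distinct_e6_coords: "distinct e6_coords"
  by code_simp

text \<open>Orthogonality makes mode -1 of e^(-flip x) send e^x to a signed e^(x - flip x) without
  Heisenberg factors.\<close>

lemma cform_flip_eq_0: "x \<in> set e6_coords \<Longrightarrow> flip x \<noteq> x \<Longrightarrow> cform (flip x) x = 0"
proof -
  have "list_all (\<lambda>x. flip x = x \<or> cform (flip x) x = 0) e6_coords" by code_simp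
  then show "x \<in> set e6_coords \<Longrightarrow> flip x \<noteq> x \<Longrightarrow> cform (flip x) x = 0"
    by (auto simp: list_all_iff)
qed

text \<open>A fixed root receives its Heisenberg square from both halves of \<open>rframe\<close>, a
  moved root from one half only.\<close>

definition flip_weight :: "rcoords \<Rightarrow> int" where
  "flip_weight x = (if flip x = x then 2 else 1)"

definition gram :: "nat \<Rightarrow> nat \<Rightarrow> int" where
  "gram i j = (\<Sum>x\<leftarrow>e6_coords. flip_weight x * (wcoords x ! (i - 1) * wcoords x ! (j - 1)))"

text \<open>As a check, this is 24 times the Cartan matrix, from all 72 roots (24 is twice the
  Coxeter number), plus 12 times the Gram matrix of the simple roots projected to the fixed
  subspace, from the 24 fixed roots, of type D4.\<close>

lemma gram_values:
  "map (\<lambda>i. map (gram i) [1..<7]) [1..<7] =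
    [[60, 0, -30, 0, -6, 12], [0, 72, 0, -36, 0, 0], [-30, 0, 60, -36, 12, -6],
     [0, -36, -36, 72, -36, 0], [-6, 0, 12, -36, 60, -30], [12, 0, -6, 0, -30, 60]]"
  by code_simp

text \<open>Opposite roots have equal weight and cancel. This removes the terms
  lambda_j(-2).\<close>

lemma sum_weighted_wcoords: "j \<in> {1..6} \<Longrightarrow> (\<Sum>x\<in>set e6_coords. flip_weight x * wcoords x ! (j - 1)) = 0"
proof -
  have "list_all (\<lambda>j. (\<Sum>x\<leftarrow>e6_coords. flip_weight x * wcoords x ! (j - 1)) = 0) [1..<7]"
    by code_simp
  then show "j \<in> {1..6} \<Longrightarrow> ?thesis"
    by (simp add: list_all_iff sum_list_distinct_conv_sum_set[OF distinct_e6_coords])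
qed

text \<open>Up to the factor 1/2, this is the coefficient of e^(x - flip x) in the Casimir sum; the 48 moved roots
 have only six differences, each occurring eight times with constant sign.\<close>

definition moved_sign :: "rcoords \<Rightarrow> int" where
  "moved_sign x = (if flip x = x then 0 else cocycle_sign x x * cocycle_sign (flip x) x)"

definition flip_differences :: "rcoords list" where
  "flip_differences = [(1,0,0,0,0,-1), (0,0,1,0,-1,0), (1,0,1,0,-1,-1), (-1,0,0,0,0,1), (0,0,-1,0,1,0), (-1,0,-1,0,1,1)]"

lemma moved_differences: "list_all (\<lambda>x. flip x = x \<or> x - flip x \<in> set flip_differences) e6_coords"
  by code_simp

text \<open>Each 8, halved and then divided by 20, becomes a coefficient 1/5 of the exponential
  part.\<close>

lemma sum_moved_sign:
  "map (\<lambda>d. \<Sum>x\<leftarrow>e6_coords. if x - flip x = d then moved_sign x else 0) flip_differences = [8, 8, -8, 8, 8, -8]"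
  by code_simp

lemma gram_eq: "gram i j = (\<Sum>x\<in>set e6_coords. flip_weight x * (wcoords x ! (i - 1) * wcoords x ! (j - 1)))"
  unfolding gram_def by (rule sum_list_distinct_conv_sum_set[OF distinct_e6_coords])

lemma fock2_rlat:
  "fock2 (hv_of_lat (rlat (- x))) (hv_of_lat (rlat (- x)))
     = (\<Sum>i\<in>{1..6}. \<Sum>j\<in>{1..6}. scaleV (of_int (wcoords x ! (i - 1) * wcoords x ! (j - 1))) (qv i j))"
  unfolding fock2_def
  by (intro sum.cong refl) (simp add: hv_of_lat_def rlat_minus lookup_rlat del: wcoords.simps)

lemma fock1_rlat:
  "fock1 (hv_of_lat (rlat (- x))) n
     = (\<Sum>j\<in>{1..6}. scaleV (- of_int (wcoords x ! (j - 1))) (basisv (Poly_Mapping.single (j, n) 1, 0)))"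
  unfolding fock1_def
  by (intro sum.cong refl) (simp add: hv_of_lat_def rlat_minus lookup_rlat del: wcoords.simps)

lemma aff_rframe:
  assumes "x \<in> set e6_coords"
  shows "aff (rframe x) (-1) (basisv (rkey x)) =
     scaleV (of_int (flip_weight x) / 4) (fock2 (hv_of_lat (rlat (- x))) (hv_of_lat (rlat (- x))) + fock1 (hv_of_lat (rlat (- x))) 2)
     + scaleV (of_int (moved_sign x) / 2) (estate (rlat (x - flip x)))"
proof -
  \<comment> \<open>The pairing -2 makes the order of \<open>Em\<close> equal to 2.\<close>
  have diag: "vop (rlat (- x)) (-1) (estate (rlat x)) = scaleV (of_int (cocycle_sign x x) / 2)
      (fock2 (hv_of_lat (rlat (- x))) (hv_of_lat (rlat (- x))) + fock1 (hv_of_lat (rlat (- x))) 2)"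
  proof -
    have "rlat (- x) + rlat x = 0" by (simp add: rlat_minus)
    then show ?thesis
      using assms Em_2_vac
      by (simp add: vop_estate cocycle_rlat cocycle_sign_minus ipair_rlat cform_minus e6_coords_iff vac_eq)
  qed
  have off: "vop (rlat (- flip x)) (-1) (estate (rlat x)) = scaleV (of_int (cocycle_sign (flip x) x)) (estate (rlat (x - flip x)))"
    if "flip x \<noteq> x"
  proof -
    have "rlat (- flip x) + rlat x = rlat (x - flip x)" by (simp add: rlat_minus rlat_diff)
    then show ?thesis
      using cform_flip_eq_0[OF assms that]
      by (simp add: vop_estate cocycle_rlat cocycle_sign_minus ipair_rlat cform_minus Em_0)
  qed
  have eq: "aff (rframe x) (-1) (basisv (rkey x)) = scaleV (of_int (cocycle_sign x x) / 2)
     (vop (rlat (- x)) (-1) (estate (rlat x)) + vop (rlat (- flip x)) (-1) (estate (rlat x)))"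
    by (simp add: rframe_def module_hom.scale[OF vlin_aff_left] module_hom.add[OF vlin_aff_left] mode_rkey
       flip: basisv_rkey)
  have "cocycle_sign x x = 1 \<or> cocycle_sign x x = -1" by (simp add: cocycle_sign_def)
  then show ?thesis
  proof (cases "flip x = x")
    case True
    show ?thesis
      using \<open>cocycle_sign x x = 1 \<or> cocycle_sign x x = -1\<close>
      unfolding eq True diag poly_mapping_eq_iff fun_eq_iff lookup_add lookup_scaleV
      by (auto simp: True flip_weight_def moved_sign_def)
  next
    case False
    show ?thesis
      using \<open>cocycle_sign x x = 1 \<or> cocycle_sign x x = -1\<close>
      unfolding eq diag off[OF False] poly_mapping_eq_iff fun_eq_iff lookup_add lookup_scaleV
      by (auto simp: False flip_weight_def moved_sign_def field_simps)
  qed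
qed

lemma heis_neg1_hkey:
  assumes "i \<in> {1..6}"
  shows "heis (fwv i) (-1) (basisv (hkey j)) = qv i j"
proof -
  have "heis (fwv i) (-1) (basisv (hkey j))
     = (\<Sum>k\<in>{1..6}. if k = i then basisv (Poly_Mapping.single (j, 1) 1 + Poly_Mapping.single (i, 1) 1, 0) else 0)"
    using heis_neg_basisv[of 1 "fwv i"] unfolding hkey_def
    by (auto simp: fwv_def simp del: sum.delta sum.delta' intro!: sum.cong)
  then show ?thesis using assms by (simp add: qv_def add.commute)
qed

lemma aff_hframe:
  "aff (hframe j) (-1) (basisv (hkey j))
     = (\<Sum>i\<in>{1..6}. scaleV (of_int (cartan i j + cartan i (tperm j)) / 2) (qv i j))"
  unfolding hframe_def module_hom.sum[OF vlin_aff_left] module_hom.scale[OF vlin_aff_left]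
  by (intro sum.cong refl) (simp add: mode_hkey heis_neg1_hkey)

lemma sum_aff_rframe:
  "(\<Sum>x\<in>set e6_coords. aff (rframe x) (-1) (basisv (rkey x)))
     = (\<Sum>i\<in>{1..6}. \<Sum>j\<in>{1..6}. scaleV (of_int (gram i j) / 4) (qv i j))
       + (\<Sum>x\<in>set e6_coords. scaleV (of_int (moved_sign x) / 2) (estate (rlat (x - flip x))))"
proof -
  have "(\<Sum>x\<in>set e6_coords. scaleV (of_int (flip_weight x) / 4) (fock2 (hv_of_lat (rlat (- x))) (hv_of_lat (rlat (- x)))))
     = (\<Sum>x\<in>set e6_coords. \<Sum>i\<in>{1..6}. \<Sum>j\<in>{1..6}.
          scaleV (of_int (flip_weight x * (wcoords x ! (i - 1) * wcoords x ! (j - 1))) / 4) (qv i j))"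
    unfolding fock2_rlat by (simp add: V.scale_sum_right)
  also have "\<dots> = (\<Sum>i\<in>{1..6}. \<Sum>j\<in>{1..6}. \<Sum>x\<in>set e6_coords.
          scaleV (of_int (flip_weight x * (wcoords x ! (i - 1) * wcoords x ! (j - 1))) / 4) (qv i j))"
    by (subst sum.swap, intro sum.cong refl, rule sum.swap)
  also have "\<dots> = (\<Sum>i\<in>{1..6}. \<Sum>j\<in>{1..6}. scaleV (of_int (gram i j) / 4) (qv i j))"
    unfolding gram_eq of_int_sum sum_divide_distrib V.scale_sum_left ..
  finally have quad: "(\<Sum>x\<in>set e6_coords. scaleV (of_int (flip_weight x) / 4) (fock2 (hv_of_lat (rlat (- x))) (hv_of_lat (rlat (- x)))))
     = (\<Sum>i\<in>{1..6}. \<Sum>j\<in>{1..6}. scaleV (of_int (gram i j) / 4) (qv i j))" .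
  have "(\<Sum>x\<in>set e6_coords. scaleV (of_int (flip_weight x) / 4) (fock1 (hv_of_lat (rlat (- x))) 2))
     = (\<Sum>x\<in>set e6_coords. \<Sum>j\<in>{1..6}.
          scaleV (of_int (flip_weight x * wcoords x ! (j - 1)) * (- 1 / 4)) (basisv (Poly_Mapping.single (j, 2) 1, 0)))"
    unfolding fock1_rlat by (simp add: V.scale_sum_right)
  also have "\<dots> = (\<Sum>j\<in>{1..6}. \<Sum>x\<in>set e6_coords.
          scaleV (of_int (flip_weight x * wcoords x ! (j - 1)) * (- 1 / 4)) (basisv (Poly_Mapping.single (j, 2) 1, 0)))"
    by (rule sum.swap)
  also have "\<dots> = (\<Sum>j\<in>{1..6}. scaleV (of_int (\<Sum>x\<in>set e6_coords. flip_weight x * wcoords x ! (j - 1)) * (- 1 / 4))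
       (basisv (Poly_Mapping.single (j, 2) 1, 0)))"
    unfolding of_int_sum sum_distrib_right V.scale_sum_left ..
  also have "\<dots> = 0"
    by (intro sum.neutral ballI) (simp add: sum_weighted_wcoords del: atLeastAtMost_iff)
  finally have "(\<Sum>x\<in>set e6_coords. scaleV (of_int (flip_weight x) / 4) (fock1 (hv_of_lat (rlat (- x))) 2)) = 0" .
  with quad show ?thesis
    by (simp add: aff_rframe sum.distrib V.scale_right_distrib cong: sum.cong)
qed

lemma sum_moved_estate:
  "(\<Sum>x\<in>set e6_coords. scaleV (of_int (moved_sign x) / 2) (estate (rlat (x - flip x))))
     = scaleV 4 (estate (sroot 1 - sroot 6) + estate (sroot 3 - sroot 5)
        - estate (sroot 1 + sroot 3 - sroot 5 - sroot 6))
   + scaleV 4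
       (estate (- sroot 1 + sroot 6) + estate (- sroot 3 + sroot 5)
        - estate (- sroot 1 - sroot 3 + sroot 5 + sroot 6))"
proof -
  let ?s = "\<lambda>x. scaleV (of_int (moved_sign x) / 2) (estate (rlat (x - flip x)))"
  let ?M = "{x \<in> set e6_coords. flip x \<noteq> x}"
  let ?S = "\<lambda>d. \<Sum>x\<leftarrow>e6_coords. if x - flip x = d then moved_sign x else 0"
  have "sum ?s (set e6_coords) = sum ?s ?M"
    by (rule sum.mono_neutral_right) (auto simp: moved_sign_def)
  \<comment> \<open>The moved roots are grouped by the exponent to which they contribute.\<close>
  also have "\<dots> = (\<Sum>d\<in>set flip_differences. sum ?s {x \<in> ?M. x - flip x = d})"
    using moved_differences by (intro sum.group[symmetric]) (auto simp: list_all_iff)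
  also have "\<dots> = (\<Sum>d\<in>set flip_differences. scaleV (of_int (?S d) / 2) (estate (rlat d)))"
  proof (intro sum.cong refl)
    fix d
    have "?S d = (\<Sum>x\<in>set e6_coords. if x - flip x = d then moved_sign x else 0)"
      by (rule sum_list_distinct_conv_sum_set[OF distinct_e6_coords])
    also have "\<dots> = (\<Sum>x\<in>{x \<in> ?M. x - flip x = d}. moved_sign x)"
      by (rule sum.mono_neutral_cong_right) (auto simp: moved_sign_def split: if_splits)
    finally show "sum ?s {x \<in> ?M. x - flip x = d} = scaleV (of_int (?S d) / 2) (estate (rlat d))"
      by (auto simp: sum_divide_distrib V.scale_sum_left intro!: sum.cong)
  qed
  also have "\<dots> = (\<Sum>d\<leftarrow>flip_differences. scaleV (of_int (?S d) / 2) (estate (rlat d)))"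
    by (rule sum_list_distinct_conv_sum_set[symmetric]) (simp add: flip_differences_def)
  \<comment> \<open>Zipping makes the list of coefficients appear literally as in
    \<open>sum_moved_sign\<close>, so that it can be replaced by its value.\<close>
  also have "\<dots> = (\<Sum>(c, d)\<leftarrow>zip (map ?S flip_differences) flip_differences. scaleV (of_int c / 2) (estate (rlat d)))"
    by (simp add: zip_map1 zip_same_conv_map comp_def)
  finally have eq: "sum ?s (set e6_coords) =
    (\<Sum>(c, d)\<leftarrow>zip [8, 8, -8, 8, 8, -8] flip_differences. scaleV (of_int c / 2) (estate (rlat d)))"
    unfolding sum_moved_sign .
  have simple: "sroot 1 = rlat (1,0,0,0,0,0)" "sroot 3 = rlat (0,0,1,0,0,0)" "sroot 5 = rlat (0,0,0,0,1,0)" "sroot 6 = rlat (0,0,0,0,0,1)"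
    by (auto simp: sroot_def rlat_def lookup_lat_of cartan_def cartanL_def intro!: poly_mapping_eqI elim!: cases_1_6)
  have plus: "rlat x + rlat y = rlat (x + y)" for x y
    using rlat_diff[of x "- y"] by (simp add: rlat_minus)
  show ?thesis
    unfolding eq simple plus rlat_minus[symmetric] rlat_diff[symmetric]
    by (simp add: flip_differences_def V.scale_right_distrib V.scale_right_diff_distrib)
qed

section \<open>States created from the vacuum and the normally ordered sum\<close>

lemma vop_neg1_vac: "vop (rlat x) (-1) vac = estate (rlat x)"
proof -
  have "cocycle_exponent x 0 = 0" "cform x 0 = 0" by (cases x; simp add: zero_prod_def)+
  then show ?thesis
    using cocycle_rlat[of x 0] ipair_rlat[of x 0]
    by (simp add: vac_eq vop_estate rlat_0 cocycle_sign_def Em_0)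
qed

lemma aff_neg1_vac:
  assumes "b \<in> gE6" shows "aff b (-1) vac = b"
proof -
  have h: "heis (fwv j) (-1) vac = basisv (hkey j)" if "j \<in> {1..6}" for j
  proof -
    have "heis (fwv j) (-1) vac = (\<Sum>k\<in>{1..6}. if k = j then basisv (hkey j) else 0)"
      using heis_vac[of 1 "fwv j"] unfolding fock1_def
      by (auto simp: fwv_def hkey_def simp del: sum.delta sum.delta' intro!: sum.cong)
    then show ?thesis using that by simp
  qed
  have "aff b (-1) vac = (\<Sum>x\<in>set e6_coords. scaleV (Poly_Mapping.lookup b (rkey x)) (vop (rlat x) (-1) vac))
     + (\<Sum>j\<in>{1..6}. scaleV (Poly_Mapping.lookup b (hkey j)) (mode_b (hkey j) (-1) vac))"
    unfolding arg_cong[OF gE6_expand[OF assms], of "\<lambda>b. aff b (-1) vac"]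
    by (simp add: module_hom.add[OF vlin_aff_left] module_hom.sum[OF vlin_aff_left]
        module_hom.scale[OF vlin_aff_left] mode_rkey)
  also have "\<dots> = b"
    unfolding vop_neg1_vac basisv_rkey[symmetric]
    using gE6_expand[OF assms] by (simp add: h mode_hkey del: atLeastAtMost_iff cong: sum.cong)
  finally show ?thesis .
qed

text \<open>For n >= 2 the mode n - 2 of \<open>b\<close> acts first and kills the vacuum; for n <=
  0 the order is reversed and the mode -n of \<open>a\<close> kills it. For n = 1 the mode -1 of
  \<open>b\<close> creates \<open>b\<close> itself.\<close>

lemma nord_vac:
  assumes "b \<in> gE6"
  shows "nord a (- n) b (n - 2) vac = (if n = 1 then aff a (-1) b else 0)"
proof -
  consider "n \<ge> 2" | "n = 1" | "n \<le> 0" by linarith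
  then show ?thesis
    by cases (auto simp: nord_def nonneg_mode_vac aff_neg1_vac[OF assms] module_hom.zero[OF vlin_aff_right])
qed

lemma omegaF4_eq:
  assumes "\<And>i. i < N \<Longrightarrow> u' i \<in> aF4"
  shows "omegaF4 N u u' = scaleV (1 / 20) (\<Sum>i<N. aff (u i) (-1) (u' i))"
proof -
  have "(\<Sum>i<N. nord (u i) (- n) (u' i) (n - 2) vac) = (if n = 1 then \<Sum>i<N. aff (u i) (-1) (u' i) else 0)" for n
    using assms by (simp add: nord_vac aF4_def)
  \<comment> \<open>\<open>Sum_any\<close> returns 0 on infinite support by default; here the
    support lies in {1}.\<close>
  moreover have "Sum_any (\<lambda>n::int. if n = 1 then s else 0) = s" for s :: V
    by (subst Sum_any.expand_superset[of "{1}"]) auto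
  ultimately show ?thesis by (simp add: omegaF4_def)
qed

text \<open>Supplies the frame identity for \<open>casimir_change_of_frame\<close>; the disjoint sum
  merges root and weight keys into one index set.\<close>

lemma aF4_frame:
  assumes "y \<in> aF4"
  shows "y = (\<Sum>k\<in>set e6_coords <+> {1..6}. scaleV (invform (case_sum rframe hframe k) y)
        (basisv (case_sum rkey hkey k)))"
proof -
  have "y \<in> gE6" using assms by (simp add: aF4_def)
  have "y = (\<Sum>x\<in>set e6_coords. scaleV (invform (rframe x) y) (basisv (rkey x)))
     + (\<Sum>j\<in>{1..6}. scaleV (invform (hframe j) y) (basisv (hkey j)))"
    using gE6_expand[OF \<open>y \<in> gE6\<close>] assms
    by (simp add: invform_rframe invform_hframe del: atLeastAtMost_iff cong: sum.cong)
  then show ?thesis by (simp add: sum.Plus)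
qed

theorem theorem5p1:
  fixes N :: nat and u u' :: "nat \<Rightarrow> V"
  assumes basis_in: "\<forall>i<N. u i \<in> aF4"
    and dual_in: "\<forall>i<N. u' i \<in> aF4"
    and dual: "\<forall>i<N. \<forall>j<N. invform (u i) (u' j) = (if i = j then 1 else 0)"
    and spans: "\<forall>v\<in>aF4. \<exists>c. v = (\<Sum>i<N. scaleV (c i) (u i))"
  shows "omegaF4 N u u' =
     scaleV (1 / 5)
       (scaleV 4 (qv 1 1) - scaleV 4 (qv 1 3) - qv 1 5 + scaleV 2 (qv 1 6)
        + scaleV 5 (qv 2 2) - scaleV 5 (qv 2 4) + scaleV 4 (qv 3 3) - scaleV 5 (qv 3 4)
        + scaleV 2 (qv 3 5) - qv 3 6 + scaleV 5 (qv 4 4) - scaleV 5 (qv 4 5)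
        + scaleV 4 (qv 5 5) - scaleV 4 (qv 5 6) + scaleV 4 (qv 6 6))
   + scaleV (1 / 5)
       (estate (sroot 1 - sroot 6) + estate (sroot 3 - sroot 5)
        - estate (sroot 1 + sroot 3 - sroot 5 - sroot 6))
   + scaleV (1 / 5)
       (estate (- sroot 1 + sroot 6) + estate (- sroot 3 + sroot 5)
        - estate (- sroot 1 - sroot 3 + sroot 5 + sroot 6))"
proof -
  have "(\<Sum>i<N. aff (u i) (-1) (u' i))
     = (\<Sum>k\<in>set e6_coords <+> {1..6}. aff (case_sum rframe hframe k) (-1) (basisv (case_sum rkey hkey k)))"
    using dual_in dual spans aF4_frame
    by (intro casimir_change_of_frame[where F = invform and A = aF4] vlin_aff_left vlin_aff_right
          module_hom_invform_left)
       (auto simp: rframe_in_aF4 hframe_in_aF4 simp del: atLeastAtMost_iff)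
  also have "\<dots> = (\<Sum>x\<in>set e6_coords. aff (rframe x) (-1) (basisv (rkey x)))
     + (\<Sum>j\<in>{1..6}. aff (hframe j) (-1) (basisv (hkey j)))"
    by (simp add: sum.Plus)
  finally have sum: "(\<Sum>i<N. aff (u i) (-1) (u' i)) = \<dots>" .
  \<comment> \<open>Creation operators commute, so symmetric entries can be collected at i <=
    j.\<close>
  have qv_commute: "qv 2 1 = qv 1 2" "qv 3 1 = qv 1 3" "qv 4 1 = qv 1 4" "qv 5 1 = qv 1 5" "qv 6 1 = qv 1 6"
     "qv 3 2 = qv 2 3" "qv 4 2 = qv 2 4" "qv 5 2 = qv 2 5" "qv 6 2 = qv 2 6"
     "qv 4 3 = qv 3 4" "qv 5 3 = qv 3 5" "qv 6 3 = qv 3 6"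
     "qv 5 4 = qv 4 5" "qv 6 4 = qv 4 6" "qv 6 5 = qv 5 6"
    by (simp_all add: qv_def add.commute)
  \<comment> \<open>Off-diagonal entries count twice: for lambda_1 lambda_6 the total is 2 * (12/4 +
    2/2) = 8 = 4 * 2.\<close>
  have quad: "(\<Sum>i\<in>{1..6}. \<Sum>j\<in>{1..6}. scaleV (of_int (gram i j) / 4) (qv i j))
      + (\<Sum>j\<in>{1..6}. \<Sum>i\<in>{1..6}. scaleV (of_int (cartan i j + cartan i (tperm j)) / 2) (qv i j))
    = scaleV 4 (scaleV 4 (qv 1 1) - scaleV 4 (qv 1 3) - qv 1 5 + scaleV 2 (qv 1 6)
        + scaleV 5 (qv 2 2) - scaleV 5 (qv 2 4) + scaleV 4 (qv 3 3) - scaleV 5 (qv 3 4)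
        + scaleV 2 (qv 3 5) - qv 3 6 + scaleV 5 (qv 4 4) - scaleV 5 (qv 4 5)
        + scaleV 4 (qv 5 5) - scaleV 4 (qv 5 6) + scaleV 4 (qv 6 6))"
    using gram_values
    unfolding poly_mapping_eq_iff fun_eq_iff lookup_add lookup_minus lookup_sum lookup_scaleV
    by (simp add: sum_1_6 upt_rec qv_commute cartan_def cartanL_def tperm_def field_simps)
  have omega: "omegaF4 N u u' = scaleV (1 / 20) (\<Sum>i<N. aff (u i) (-1) (u' i))"
    using dual_in by (intro omegaF4_eq) simp
  \<comment> \<open>The common factor 4 of all three parts turns 1/20 into 1/5.\<close>
  have collect: "scaleV (1 / 20) (a + (scaleV 4 c + scaleV 4 d) + b) = scaleV (1 / 5) q + scaleV (1 / 5) c + scaleV (1 / 5) d"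
    if "a + b = scaleV 4 q" for a b c d q :: V
  proof -
    have eq: "a + (scaleV 4 c + scaleV 4 d) + b = scaleV 4 q + scaleV 4 c + scaleV 4 d"
      unfolding that[symmetric] by (simp only: ac_simps)
    show ?thesis unfolding eq by (simp add: V.scale_right_distrib)
  qed
  show ?thesis
    unfolding omega sum sum_aff_rframe aff_hframe sum_moved_estate by (rule collect[OF quad])
qed

end
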